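(* If $G$ is a cubic Halin graph, then $\chi'_{st}(G)\ge 5$.
   Context: All graphs are finite and simple. For $k\ge 1$ let $[k]=\{1,2,\dots,k\}$. A star $k$-edge coloring of a graph $G$ is a proper edge-coloring $c:E(G)\to[k]$ such that no path of length four (four edges) and no cycle of length four in $G$ is bi-colored (i.e. uses only two colors) under $c$. The star chromatic index $\chi'_{st}(G)$ is the smallest integer $k$ such that $G$ admits a star $k$-edge coloring. A Halin graph $G=T\cup C$ is a planar graph that consists of a plane embedding of a tree $T$ that has no vertices of degree two, together with a cycle $C$ connecting all the leaves of $T$ such that $C$ is the boundary of the exterior face. The tree $T$ is called the characteristic tree. If every non-leaf vertex of $T$ has degree exactly $3$ in $T$, then $G$ is called a cubic Halin graph. *)

theory Defs
  imports "HOL-Analysis.Analysis"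
begin

text \<open>A graph is given by its vertex set \<open>V\<close> and its set \<open>E\<close> of edges, which are two-element
  subsets of \<open>V\<close>.\<close>

definition simple_graph :: "'a set \<Rightarrow> 'a set set \<Rightarrow> bool" where
  "simple_graph V E \<longleftrightarrow> finite V \<and> (\<forall>e\<in>E. e \<subseteq> V \<and> card e = 2)"

definition vdegree :: "'a set set \<Rightarrow> 'a \<Rightarrow> nat" where
  "vdegree E v = card {e \<in> E. v \<in> e}"

text \<open>Paths and cycles are represented by the lists of their vertices in order; the closing edge of
  a cycle joins the last vertex to the first one. The length in the graph-theoretic sense is the
  number of edges: a path of length four is a list of five vertices, a cycle of length four a list
  of four.\<close>

definition path_edges :: "'a list \<Rightarrow> 'a set set" where
  "path_edges p = {{p ! i, p ! Suc i} | i. Suc i < length p}"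

definition cycle_edges :: "'a list \<Rightarrow> 'a set set" where
  "cycle_edges p = insert {last p, hd p} (path_edges p)"

definition is_path :: "'a set \<Rightarrow> 'a set set \<Rightarrow> 'a list \<Rightarrow> bool" where
  "is_path V E p \<longleftrightarrow> p \<noteq> [] \<and> distinct p \<and> set p \<subseteq> V \<and> path_edges p \<subseteq> E"

definition is_cycle :: "'a set \<Rightarrow> 'a set set \<Rightarrow> 'a list \<Rightarrow> bool" where
  "is_cycle V E p \<longleftrightarrow> length p \<ge> 3 \<and> distinct p \<and> set p \<subseteq> V \<and> cycle_edges p \<subseteq> E"

definition connected_graph :: "'a set \<Rightarrow> 'a set set \<Rightarrow> bool" where
  "connected_graph V E \<longleftrightarrow>
     V \<noteq> {} \<and> (\<forall>u\<in>V. \<forall>v\<in>V. \<exists>p. is_path V E p \<and> hd p = u \<and> last p = v)"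

definition is_tree :: "'a set \<Rightarrow> 'a set set \<Rightarrow> bool" where
  "is_tree V E \<longleftrightarrow> simple_graph V E \<and> connected_graph V E \<and> (\<nexists>p. is_cycle V E p)"

definition leaves :: "'a set \<Rightarrow> 'a set set \<Rightarrow> 'a set" where
  "leaves V T = {v \<in> V. vdegree T v = 1}"

definition proper_edge_coloring :: "'a set set \<Rightarrow> nat \<Rightarrow> ('a set \<Rightarrow> nat) \<Rightarrow> bool" where
  "proper_edge_coloring E k c \<longleftrightarrow>
     c ` E \<subseteq> {1..k} \<and> (\<forall>e\<in>E. \<forall>f\<in>E. e \<noteq> f \<and> e \<inter> f \<noteq> {} \<longrightarrow> c e \<noteq> c f)"

definition bicolored :: "('a set \<Rightarrow> nat) \<Rightarrow> 'a set set \<Rightarrow> bool" where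
  "bicolored c F \<longleftrightarrow> card (c ` F) = 2"

definition star_edge_coloring :: "'a set \<Rightarrow> 'a set set \<Rightarrow> nat \<Rightarrow> ('a set \<Rightarrow> nat) \<Rightarrow> bool" where
  "star_edge_coloring V E k c \<longleftrightarrow>
     proper_edge_coloring E k c \<and>
     (\<forall>p. is_path V E p \<and> length p = 5 \<longrightarrow> \<not> bicolored c (path_edges p)) \<and>
     (\<forall>p. is_cycle V E p \<and> length p = 4 \<longrightarrow> \<not> bicolored c (cycle_edges p))"

definition star_chromatic_index :: "'a set \<Rightarrow> 'a set set \<Rightarrow> nat" where
  "star_chromatic_index V E = (LEAST k. k \<ge> 1 \<and> (\<exists>c. star_edge_coloring V E k c))"

text \<open>A plane embedding places the vertices at distinct points \<open>\<phi> v\<close> and draws each edge \<open>e\<close> as an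
  arc \<open>\<gamma> e\<close> between its end points; an arc meets other vertices and other arcs only in common
  end points. The parametrisation of the arc may start at either end of the edge.\<close>

definition plane_embedding ::
    "'a set \<Rightarrow> 'a set set \<Rightarrow> ('a \<Rightarrow> complex) \<Rightarrow> ('a set \<Rightarrow> real \<Rightarrow> complex) \<Rightarrow> bool" where
  "plane_embedding V E \<phi> \<gamma> \<longleftrightarrow>
     inj_on \<phi> V \<and>
     (\<forall>e\<in>E. arc (\<gamma> e) \<and> {pathstart (\<gamma> e), pathfinish (\<gamma> e)} = \<phi> ` e
            \<and> path_image (\<gamma> e) \<inter> \<phi> ` V = \<phi> ` e) \<and>
     (\<forall>e\<in>E. \<forall>f\<in>E. e \<noteq> f \<longrightarrow> path_image (\<gamma> e) \<inter> path_image (\<gamma> f) = \<phi> ` (e \<inter> f))"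

definition drawn_edges :: "'a set set \<Rightarrow> ('a set \<Rightarrow> real \<Rightarrow> complex) \<Rightarrow> complex set" where
  "drawn_edges E \<gamma> = (\<Union>e\<in>E. path_image (\<gamma> e))"

text \<open>The points outside a compact plane set form exactly one, unbounded, component of its
  complement.\<close>

definition exterior_face ::
    "'a set \<Rightarrow> 'a set set \<Rightarrow> ('a \<Rightarrow> complex) \<Rightarrow> ('a set \<Rightarrow> real \<Rightarrow> complex) \<Rightarrow> complex set" where
  "exterior_face V E \<phi> \<gamma> = outside (\<phi> ` V \<union> drawn_edges E \<gamma>)"

text \<open>\<open>T\<close> is the edge set of the characteristic tree and \<open>C\<close> lists the vertices of the outer cycle.
  As the cycle passes through leaves of the tree only, the tree spans \<open>V\<close>.\<close>

definition halin_decomposition :: "'a set \<Rightarrow> 'a set set \<Rightarrow> 'a set set \<Rightarrow> 'a list \<Rightarrow> bool" where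
  "halin_decomposition V E T C \<longleftrightarrow>
     simple_graph V E \<and>
     is_tree V T \<and> (\<forall>v\<in>V. vdegree T v \<noteq> 2) \<and>
     is_cycle V E C \<and> set C = leaves V T \<and>
     E = T \<union> cycle_edges C \<and>
     (\<exists>\<phi> \<gamma>. plane_embedding V E \<phi> \<gamma> \<and>
            frontier (exterior_face V E \<phi> \<gamma>) = drawn_edges (cycle_edges C) \<gamma>)"

definition cubic_halin_graph :: "'a set \<Rightarrow> 'a set set \<Rightarrow> bool" where
  "cubic_halin_graph V E \<longleftrightarrow>
     (\<exists>T C. halin_decomposition V E T C \<and> (\<forall>v \<in> V - leaves V T. vdegree T v = 3))"

end

theory Submission
  imports Defs
begin

text \<open>Four colors force two parity conditions that the outer cycle cannot meet together.

  Let a cubic graph carry a star edge coloring with colors 1 to 4. Every vertex sees three colors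
  and misses one. Let \<open>v\<close> miss \<open>d\<close> and have neighbours \<open>x\<close>, \<open>y\<close>, \<open>z\<close> along edges of colors \<open>a\<close>, \<open>b\<close>,
  \<open>e\<close>. If \<open>x\<close> sees \<open>b\<close>, then \<open>y\<close> cannot see \<open>a\<close>, as this would give a walk of four edges colored
  \<open>b a b a\<close>. Chasing this around the three neighbours shows that their missing colors are one of the
  two cyclic shifts of \<open>a\<close>, \<open>b\<close>, \<open>e\<close> (\<open>missing_neighbours\<close>). This says that the coloring describes a
  covering of the 3-cube, and two consequences of that follow directly:

  \<^item> Every vertex missing \<open>d\<close> has exactly one neighbour missing \<open>f\<close>, for each other color \<open>f\<close>. So the
    four classes of vertices, by missing color, have equal size, and 4 divides the number of
    vertices (\<open>four_dvd_card\<close>).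

  \<^item> An edge \<open>v x\<close> arranges the four colors: the one missing at \<open>v\<close>, its own, the one missing at \<open>x\<close>,
    the remaining one. The cyclic shift makes the sign of this arrangement the same for all edges
    leaving \<open>v\<close>, while exchanging \<open>v\<close> and \<open>x\<close> reverses it. So the graph is bipartite, and every cycle
    has even length (\<open>even_cycle\<close>).

  In a cubic Halin graph with \<open>n\<close> leaves the tree has \<open>2 n - 2\<close> vertices (\<open>cubic_halin_card\<close>). If 4
  divides this number, then \<open>n\<close> is odd; but \<open>n\<close> is the length of the outer cycle. Finally, the star
  chromatic index is a least element, so that a lower bound also needs some star coloring to exist:
  giving all edges different colors is one.\<close>

section \<open>Counting in trees\<close>

lemma path_edgesI: "Suc i < length p \<Longrightarrow> {p ! i, p ! Suc i} \<in> path_edges p"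
  unfolding path_edges_def by blast

lemma path_edges_Cons:
  assumes "p \<noteq> []"
  shows "path_edges (u # p) = insert {u, hd p} (path_edges p)"
proof -
  have "path_edges (u # p) = (\<lambda>i. {(u # p) ! i, (u # p) ! Suc i}) ` {..<length p}"
    unfolding path_edges_def by auto
  also have "{..<length p} = insert 0 (Suc ` {..<length p - 1})"
    using assms by (cases p) (auto simp: lessThan_Suc_eq_insert_0)
  also have "(\<lambda>i. {(u # p) ! i, (u # p) ! Suc i}) ` \<dots> = insert {u, hd p} (path_edges p)"
  proof -
    have "path_edges p = (\<lambda>i. {p ! i, p ! Suc i}) ` {..<length p - 1}"
      unfolding path_edges_def by (auto simp: less_diff_conv)
    then show ?thesis using assms by (simp add: image_image hd_conv_nth)
  qed
  finally show ?thesis .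
qed

lemma path_edges_take_subset: "path_edges (take n p) \<subseteq> path_edges p"
  unfolding path_edges_def by auto

text \<open>Indexing modulo the length treats the closing edge like the others.\<close>

lemma in_cycle_edges_iff:
  assumes "length p \<ge> 3"
  shows "e \<in> cycle_edges p \<longleftrightarrow> (\<exists>i<length p. e = {p ! i, p ! (Suc i mod length p)})"
proof -
  have "(\<exists>i<length p. e = {p ! i, p ! (Suc i mod length p)}) \<longleftrightarrow>
        e = {p ! (length p - 1), p ! 0} \<or> (\<exists>i. Suc i < length p \<and> e = {p ! i, p ! Suc i})"
    (is "?L \<longleftrightarrow> ?R")
  proof
    assume ?L
    then obtain i where i: "i < length p" "e = {p ! i, p ! (Suc i mod length p)}" by blast
    show ?R
    proof (cases "Suc i = length p")
      case True
      then have "i = length p - 1" "Suc i mod length p = 0" by auto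
      with i show ?thesis by simp
    next
      case False
      with i have "Suc i < length p" "e = {p ! i, p ! Suc i}" by auto
      then show ?thesis by blast
    qed
  next
    assume ?R
    then show ?L
    proof
      assume "e = {p ! (length p - 1), p ! 0}"
      moreover have "Suc (length p - 1) = length p" using assms by linarith
      ultimately show ?L using assms by (intro exI[of _ "length p - 1"]) auto
    next
      assume "\<exists>i. Suc i < length p \<and> e = {p ! i, p ! Suc i}"
      then obtain i where "Suc i < length p" "e = {p ! i, p ! Suc i}" by blast
      then show ?L by (intro exI[of _ i]) auto
    qed
  qed
  moreover have "p \<noteq> []" using assms by auto
  ultimately show ?thesis
    unfolding cycle_edges_def path_edges_def by (auto simp: last_conv_nth hd_conv_nth)
qed

lemma simple_graph_edgeE:
  assumes "simple_graph V E" "e \<in> E" "x \<in> e"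
  obtains y where "e = {x, y}" "y \<noteq> x" "x \<in> V" "y \<in> V"
proof -
  have "card e = 2" "e \<subseteq> V" using assms unfolding simple_graph_def by auto
  then show ?thesis using that assms(3) by (auto simp: card_2_iff)
qed

lemma simple_graph_finite_edges:
  assumes "simple_graph V E"
  shows "finite E"
  using assms unfolding simple_graph_def by (intro finite_subset[of E "Pow V"]) auto

lemma sum_vdegree:
  assumes "simple_graph V E"
  shows "(\<Sum>v\<in>V. vdegree E v) = 2 * card E"
proof -
  have fin: "finite V" "finite E"
    using assms simple_graph_finite_edges by (auto simp: simple_graph_def)
  have "(\<Sum>v\<in>V. vdegree E v) = (\<Sum>v\<in>V. \<Sum>e\<in>E. if v \<in> e then 1 else 0)"
    using fin unfolding vdegree_def by (simp add: sum.If_cases Int_def)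
  also have "\<dots> = (\<Sum>e\<in>E. \<Sum>v\<in>V. if v \<in> e then 1 else 0)"
    by (rule sum.swap)
  also have "\<dots> = (\<Sum>e\<in>E. 2)"
  proof (rule sum.cong)
    fix e assume "e \<in> E"
    then have "e \<subseteq> V" "card e = 2" using assms unfolding simple_graph_def by auto
    moreover from \<open>e \<subseteq> V\<close> have "{v \<in> V. v \<in> e} = e" by auto
    ultimately show "(\<Sum>v\<in>V. if v \<in> e then 1 else 0) = (2::nat)"
      using fin by (simp add: sum.If_cases Int_def)
  qed simp
  finally show ?thesis by simp
qed

text \<open>An end vertex of a longest path has all its neighbours on that path, and a neighbour beyond
  the second vertex would close a cycle.\<close>

lemma tree_has_leaf:
  assumes tree: "is_tree V T" and "card V \<ge> 2"
  obtains v w where "v \<in> V" "{e \<in> T. v \<in> e} = {{v, w}}"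
proof -
  have sg: "simple_graph V T" and con: "connected_graph V T" and acy: "\<nexists>p. is_cycle V T p"
    using tree unfolding is_tree_def by auto
  have finV: "finite V" using sg unfolding simple_graph_def by simp
  obtain x y where xy: "x \<in> V" "y \<in> V" "x \<noteq> y"
    using \<open>card V \<ge> 2\<close> by (meson card_2_iff' ex_card subset_iff)
  obtain q where q: "is_path V T q" "hd q = x" "last q = y"
    using con xy unfolding connected_graph_def by blast
  have lenq: "length q \<ge> 2"
    using q xy(3) unfolding is_path_def by (cases q; cases "tl q") auto
  have bound: "length p \<le> card V" if "is_path V T p" for p
    using that finV unfolding is_path_def by (metis card_mono distinct_card)
  obtain p where p: "is_path V T p" and max: "\<And>p'. is_path V T p' \<Longrightarrow> length p' \<le> length p"
    using ex_has_greatest_nat[of "is_path V T" q length "Suc (card V)"] q(1) bound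
    by (auto simp: less_Suc_eq_le)
  have len: "length p \<ge> 2" using max[OF q(1)] lenq by simp
  have ne: "p \<noteq> []" and dist: "distinct p" and sub: "set p \<subseteq> V" and pe: "path_edges p \<subseteq> T"
    using p unfolding is_path_def by auto
  define v where "v = p ! 0"
  define w where "w = p ! 1"
  have hd: "hd p = v" unfolding v_def using ne by (simp add: hd_conv_nth)
  have vV: "v \<in> V" using sub len unfolding v_def by (meson nth_mem less_le_trans pos2 subsetD)
  have edge: "{v, w} \<in> T" using pe path_edgesI[of 0 p] len unfolding v_def w_def by auto
  have "e = {v, w}" if e: "e \<in> T" "v \<in> e" for e
  proof -
    obtain u where u: "e = {v, u}" "u \<noteq> v" "u \<in> V" using simple_graph_edgeE[OF sg e] by metis
    have "u \<in> set p"
    proof (rule ccontr)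
      assume "u \<notin> set p"
      then have "is_path V T (u # p)"
        using u e ne dist sub pe unfolding is_path_def
        by (auto simp: path_edges_Cons hd insert_commute)
      then show False using max by fastforce
    qed
    then obtain i where i: "i < length p" "u = p ! i" by (auto simp: in_set_conv_nth)
    have "i \<noteq> 0" using u(2) i unfolding v_def by metis
    have "\<not> i \<ge> 2"
    proof
      assume i2: "i \<ge> 2"
      let ?q = "take (Suc i) p"
      have "hd ?q = v" using hd by simp
      moreover have "last ?q = u" using i by (simp add: take_Suc_conv_app_nth)
      ultimately have "is_cycle V T ?q"
        using i i2 dist sub pe path_edges_take_subset[of "Suc i" p] e(1) u(1)
        unfolding is_cycle_def cycle_edges_def
        by (auto simp: insert_commute dest: in_set_takeD)
      then show False using acy by blast
    qed
    then have "i = 1" using \<open>i \<noteq> 0\<close> by simp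
    then show ?thesis using u i unfolding w_def by simp
  qed
  then have "{e \<in> T. v \<in> e} = {{v, w}}" using edge by blast
  then show ?thesis using that[OF vV] by simp
qed

lemma is_tree_remove_leaf:
  assumes tree: "is_tree V T" and "card V \<ge> 2"
    and v: "v \<in> V" and edges: "{e \<in> T. v \<in> e} = {f}"
  shows "is_tree (V - {v}) (T - {f})"
proof -
  have sg: "simple_graph V T" and con: "connected_graph V T" and acy: "\<nexists>p. is_cycle V T p"
    using tree unfolding is_tree_def by auto
  have f: "v \<in> e \<longleftrightarrow> e = f" if "e \<in> T" for e
  proof -
    have "e \<in> {e \<in> T. v \<in> e} \<longleftrightarrow> e \<in> {f}" by (simp only: edges)
    then show ?thesis using that by simp
  qed
  have "simple_graph (V - {v}) (T - {f})"
    using sg f unfolding simple_graph_def by auto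
  moreover have "is_cycle V T p" if "is_cycle (V - {v}) (T - {f}) p" for p
    using that unfolding is_cycle_def by auto
  then have "\<nexists>p. is_cycle (V - {v}) (T - {f}) p" using acy by blast
  moreover have "connected_graph (V - {v}) (T - {f})"
    unfolding connected_graph_def
  proof (intro conjI ballI)
    have "card (V - {v}) \<ge> 1" using \<open>card V \<ge> 2\<close> v by (simp add: card_Diff_singleton)
    then show "V - {v} \<noteq> {}" by force
  next
    fix x y assume x: "x \<in> V - {v}" and y: "y \<in> V - {v}"
    then obtain p where p: "is_path V T p" "hd p = x" "last p = y"
      using con unfolding connected_graph_def by blast
    have ne: "p \<noteq> []" and dist: "distinct p" and pe: "path_edges p \<subseteq> T"
      using p unfolding is_path_def by auto
    \<comment> \<open>An inner vertex of a path lies on two edges of it, so the path avoids \<open>v\<close>.\<close>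
    have vp: "v \<notin> set p"
    proof
      assume "v \<in> set p"
      then obtain i where i: "i < length p" "v = p ! i" by (auto simp: in_set_conv_nth)
      have "i \<noteq> 0" using i x p(2) ne by (metis DiffD2 hd_conv_nth singletonI)
      moreover have "Suc i \<noteq> length p"
        using i y p(3) ne by (metis DiffD2 diff_Suc_1 last_conv_nth singletonI)
      ultimately obtain j where j: "i = Suc j" "Suc (Suc j) < length p"
        using i(1) by (metis Suc_lessI not0_implies_Suc)
      have "{p ! j, v} = f" "{v, p ! Suc i} = f"
        using path_edgesI[of j p] path_edgesI[of i p] j i pe f by auto
      then have "p ! j = p ! Suc i" by (auto simp: doubleton_eq_iff)
      then show False using dist j by (simp add: nth_eq_iff_index_eq)
    qed
    have "path_edges p \<subseteq> T - {f}"
    proof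
      fix e assume e: "e \<in> path_edges p"
      then have "e \<subseteq> set p" unfolding path_edges_def by auto
      then have "v \<notin> e" using vp by blast
      moreover have "e \<in> T" using e pe by blast
      ultimately show "e \<in> T - {f}" using f by blast
    qed
    then show "\<exists>p. is_path (V - {v}) (T - {f}) p \<and> hd p = x \<and> last p = y"
      using p vp unfolding is_path_def by (intro exI[of _ p]) auto
  qed
  ultimately show ?thesis unfolding is_tree_def by simp
qed

lemma card_tree:
  assumes "is_tree V T"
  shows "card V = card T + 1"
  using assms
proof (induction "card V" arbitrary: V T rule: less_induct)
  case less
  have sg: "simple_graph V T" and "V \<noteq> {}"
    using less.prems unfolding is_tree_def connected_graph_def by auto
  have finV: "finite V" using sg unfolding simple_graph_def by simp
  have finT: "finite T" using simple_graph_finite_edges[OF sg] .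
  show ?case
  proof (cases "card V \<ge> 2")
    case True
    then obtain v w where v: "v \<in> V" "{e \<in> T. v \<in> e} = {{v, w}}"
      using tree_has_leaf[OF less.prems] by metis
    have "card (V - {v}) < card V" using v(1) finV by (rule card_Diff1_less[rotated])
    then have "card (V - {v}) = card (T - {{v, w}}) + 1"
      using less.hyps is_tree_remove_leaf[OF less.prems True v] by blast
    moreover have "{v, w} \<in> T" using v(2) by blast
    ultimately show ?thesis
      using v(1) finV finT card_Suc_Diff1[of V v] card_Suc_Diff1[of T "{v, w}"] by linarith
  next
    case False
    moreover have "card V \<noteq> 0" using \<open>V \<noteq> {}\<close> finV by simp
    ultimately have "card V = 1" by linarith
    moreover have "T = {}"
    proof (rule ccontr)
      assume "T \<noteq> {}"
      then obtain e where "e \<subseteq> V" "card e = 2" using sg unfolding simple_graph_def by blast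
      then show False using card_mono[OF finV, of e] False by simp
    qed
    ultimately show ?thesis by simp
  qed
qed

section \<open>Degrees in a cubic Halin graph\<close>

lemma vdegree_cycle_edges:
  assumes len: "length p \<ge> 3" and dist: "distinct p" and x: "x \<in> set p"
  shows "vdegree (cycle_edges p) x = 2"
proof -
  let ?n = "length p"
  obtain j where j: "j < ?n" "x = p ! j" using x by (auto simp: in_set_conv_nth)
  define l where "l = (if j = 0 then ?n - 1 else j - 1)"
  define r where "r = Suc j mod ?n"
  have pos: "0 < ?n" using len by linarith
  have nxt: "Suc i mod ?n = (if Suc i = ?n then 0 else Suc i)" if "i < ?n" for i
    using that by simp
  have l: "l < ?n" using j(1) len unfolding l_def by (simp; linarith)
  then have l': "Suc l mod ?n = j"
    using nxt[OF l] j(1) len unfolding l_def by (simp split: if_splits)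
  have r: "r < ?n" unfolding r_def by (rule mod_less_divisor[OF pos])
  have lr: "l \<noteq> r" unfolding l_def r_def nxt[OF j(1)] using len
    by (cases "j = 0"; cases "Suc j = ?n") simp_all
  have only: "i = j \<or> i = l" if "i < ?n" "j = i \<or> j = Suc i mod ?n" for i
    using that(2) len unfolding nxt[OF that(1)] l_def by (auto split: if_splits)
  have "{e \<in> cycle_edges p. x \<in> e} = {{x, p ! r}, {p ! l, x}}"
  proof (intro equalityI subsetI)
    fix e assume "e \<in> {e \<in> cycle_edges p. x \<in> e}"
    then obtain i where i: "i < ?n" "e = {p ! i, p ! (Suc i mod ?n)}" "x \<in> e"
      using in_cycle_edges_iff[OF len] by auto
    have "Suc i mod ?n < ?n" by (rule mod_less_divisor[OF pos])
    then have "j = i \<or> j = Suc i mod ?n"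
      using i j dist by (auto simp: nth_eq_iff_index_eq)
    then have "i = j \<or> i = l" using only i(1) by blast
    then show "e \<in> {{x, p ! r}, {p ! l, x}}" using i j l' unfolding r_def by auto
  next
    fix e assume "e \<in> {{x, p ! r}, {p ! l, x}}"
    then show "e \<in> {e \<in> cycle_edges p. x \<in> e}"
      using in_cycle_edges_iff[OF len] j l l' unfolding r_def by auto
  qed
  moreover have "p ! r \<noteq> p ! l" using lr l r dist by (simp add: nth_eq_iff_index_eq)
  then have "{x, p ! r} \<noteq> {p ! l, x}" by (auto simp: doubleton_eq_iff)
  ultimately show ?thesis unfolding vdegree_def by simp
qed

text \<open>Two adjacent leaves would be a whole component of the tree.\<close>

lemma leaves_not_adjacent:
  assumes tree: "is_tree V T" and u: "u \<in> leaves V T" and v: "v \<in> leaves V T"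
    and w: "w \<in> V" "w \<noteq> u" "w \<noteq> v"
  shows "{u, v} \<notin> T"
proof
  assume uv: "{u, v} \<in> T"
  have only: "e = f" if "x \<in> leaves V T" "e \<in> T" "f \<in> T" "x \<in> e" "x \<in> f" for e f x
  proof -
    have "card {e \<in> T. x \<in> e} = 1" using that unfolding leaves_def vdegree_def by simp
    then obtain g where "{e \<in> T. x \<in> e} = {g}" by (rule card_1_singletonE)
    then have "\<forall>h. h \<in> T \<and> x \<in> h \<longrightarrow> h = g" by (metis (lifting) mem_Collect_eq singletonD)
    then show ?thesis using that(2-5) by metis
  qed
  have "u \<in> V" using u unfolding leaves_def by simp
  then obtain p where p: "is_path V T p" "hd p = u" "last p = w"
    using tree w(1) unfolding is_tree_def connected_graph_def by blast
  have ne: "p \<noteq> []" and dist: "distinct p" and pe: "path_edges p \<subseteq> T"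
    using p unfolding is_path_def by auto
  have p0: "p ! 0 = u" using p(2) ne by (simp add: hd_conv_nth)
  have l: "p ! (length p - 1) = w" using p(3) ne by (simp add: last_conv_nth)
  have "length p \<noteq> 1" using p0 l w(2) by auto
  then have len1: "length p > 1" using ne by (cases p) auto
  have e0: "{u, p ! 1} \<in> T" using path_edgesI[of 0 p] len1 p0 pe by auto
  then have "{u, p ! 1} = {u, v}" using only[OF u e0 uv] by simp
  then have p1: "p ! 1 = v" by (auto simp: doubleton_eq_iff)
  have "length p \<noteq> 2" using l p1 w(3) by auto
  then have len2: "length p > 2" using len1 by simp
  then have "{v, p ! 2} \<in> T" using path_edgesI[of 1 p] p1 pe by (auto simp: numeral_2_eq_2)
  then have "{v, p ! 2} = {u, v}" using only[OF v _ uv] by simp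
  then have "p ! 2 = p ! 0" using p0 by (auto simp: doubleton_eq_iff)
  then have "(2::nat) = 0" using dist len2 by (subst (asm) nth_eq_iff_index_eq) auto
  then show False by simp
qed

lemma tree_disjoint_leaf_cycle:
  assumes tree: "is_tree V T" and cyc: "is_cycle V E C" and leaves: "set C = leaves V T"
  shows "T \<inter> cycle_edges C = {}"
proof (rule ccontr)
  assume "T \<inter> cycle_edges C \<noteq> {}"
  then obtain e where e: "e \<in> T" "e \<in> cycle_edges C" by blast
  have len: "length C \<ge> 3" and dist: "distinct C" using cyc unfolding is_cycle_def by auto
  obtain i where i: "i < length C" "e = {C ! i, C ! (Suc i mod length C)}"
    using e(2) in_cycle_edges_iff[OF len] by blast
  define u where "u = C ! i"
  define v where "v = C ! (Suc i mod length C)"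
  have uv: "u \<in> leaves V T" "v \<in> leaves V T"
    using i(1) mod_less_divisor[of "length C" "Suc i"] nth_mem[of _ C] leaves
    unfolding u_def v_def by fastforce+
  have "card (set C) \<ge> 3" using len dist by (simp add: distinct_card)
  moreover have "card {u, v} \<le> 2" by (simp add: card_insert_if)
  ultimately have "\<not> set C \<subseteq> {u, v}" using card_mono[of "{u, v}" "set C"] by auto
  then obtain w where "w \<in> set C" "w \<noteq> u" "w \<noteq> v" by auto
  moreover have "w \<in> V" using \<open>w \<in> set C\<close> cyc unfolding is_cycle_def by auto
  ultimately have "{u, v} \<notin> T" using leaves_not_adjacent[OF tree uv] by blast
  then show False using e(1) i unfolding u_def v_def by simp
qed

lemma cubic_halin_regular:
  assumes halin: "halin_decomposition V E T C"
    and cubic: "\<forall>v \<in> V - leaves V T. vdegree T v = 3"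
    and v: "v \<in> V"
  shows "vdegree E v = 3"
proof -
  have sg: "simple_graph V E" and tree: "is_tree V T" and cyc: "is_cycle V E C"
    and leaves: "set C = leaves V T" and E: "E = T \<union> cycle_edges C"
    using halin unfolding halin_decomposition_def by auto
  have len: "length C \<ge> 3" and dist: "distinct C" using cyc unfolding is_cycle_def by auto
  have fin: "finite T" "finite (cycle_edges C)"
    using simple_graph_finite_edges[OF sg] E by auto
  have "{e \<in> E. v \<in> e} = {e \<in> T. v \<in> e} \<union> {e \<in> cycle_edges C. v \<in> e}" using E by auto
  then have sum: "vdegree E v = vdegree T v + vdegree (cycle_edges C) v"
    using fin tree_disjoint_leaf_cycle[OF tree cyc leaves] unfolding vdegree_def
    by (subst card_Un_disjoint[symmetric]) auto
  show ?thesis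
  proof (cases "v \<in> set C")
    case True
    then have "vdegree T v = 1" using leaves unfolding leaves_def by simp
    then show ?thesis using sum vdegree_cycle_edges[OF len dist True] by simp
  next
    case False
    have "e \<subseteq> set C" if e: "e \<in> cycle_edges C" for e
    proof -
      obtain i where i: "i < length C" "e = {C ! i, C ! (Suc i mod length C)}"
        using iffD1[OF in_cycle_edges_iff[OF len] e] by blast
      moreover have "0 < length C" using len by linarith
      then have "Suc i mod length C < length C" by (rule mod_less_divisor)
      ultimately show ?thesis by simp
    qed
    then have "{e \<in> cycle_edges C. v \<in> e} = {}" using False by blast
    then have "vdegree (cycle_edges C) v = 0" unfolding vdegree_def by (simp only: card.empty)
    moreover have "vdegree T v = 3" using cubic v False leaves by auto
    ultimately show ?thesis using sum by simp
  qed
qed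

text \<open>The degree sum of the tree is \<open>n + 3 (|V| - n)\<close> for \<open>n\<close> leaves, and also twice the number
  \<open>|V| - 1\<close> of its edges.\<close>

lemma cubic_halin_card:
  assumes halin: "halin_decomposition V E T C"
    and cubic: "\<forall>v \<in> V - leaves V T. vdegree T v = 3"
  shows "card V + 2 = 2 * length C"
proof -
  have tree: "is_tree V T" and cyc: "is_cycle V E C" and leaves: "set C = leaves V T"
    using halin unfolding halin_decomposition_def by auto
  have sg: "simple_graph V T" using tree unfolding is_tree_def by simp
  have finV: "finite V" using sg unfolding simple_graph_def by simp
  have sub: "leaves V T \<subseteq> V" unfolding leaves_def by auto
  have n: "card (leaves V T) = length C"
    using cyc leaves distinct_card unfolding is_cycle_def by metis
  have "2 * card T = (\<Sum>v\<in>V. vdegree T v)" using sum_vdegree[OF sg] by simp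
  also have "\<dots> = (\<Sum>v\<in>V - leaves V T. vdegree T v) + (\<Sum>v\<in>leaves V T. vdegree T v)"
    using sum.subset_diff[OF sub finV] .
  also have "(\<Sum>v\<in>V - leaves V T. vdegree T v) = 3 * card (V - leaves V T)"
    using cubic by simp
  also have "(\<Sum>v\<in>leaves V T. vdegree T v) = length C"
    unfolding n[symmetric] by (simp add: leaves_def)
  also have "card (V - leaves V T) = card V - length C"
    using sub finV n by (metis card_Diff_subset finite_subset)
  finally have "2 * card T = 3 * (card V - length C) + length C" .
  moreover have "length C \<le> card V" using card_mono[OF finV sub] n by simp
  ultimately show ?thesis using card_tree[OF tree] by linarith
qed

section \<open>Star colorings of cubic graphs with four colors\<close>

text \<open>The Vandermonde product: antisymmetric under transpositions and nonzero on distinct arguments,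
  so it serves as the sign of an arrangement of the four colors.\<close>

definition vandermonde4 :: "int \<Rightarrow> int \<Rightarrow> int \<Rightarrow> int \<Rightarrow> int" where
  "vandermonde4 p q r s = (q - p) * (r - p) * (s - p) * (r - q) * (s - q) * (s - r)"

lemma vandermonde4_swap: "vandermonde4 r q p s = - vandermonde4 p q r s"
  unfolding vandermonde4_def by algebra

lemma vandermonde4_rotate: "vandermonde4 p r s q = vandermonde4 p q r s"
  unfolding vandermonde4_def by algebra

locale star4_colored_cubic =
  fixes V :: "'a set" and E :: "'a set set" and c :: "'a set \<Rightarrow> nat"
  assumes simple: "simple_graph V E"
    and cubic: "v \<in> V \<Longrightarrow> vdegree E v = 3"
    and star: "star_edge_coloring V E 4 c"
begin

definition nbr :: "nat \<Rightarrow> 'a \<Rightarrow> 'a \<Rightarrow> bool" where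
  "nbr a x y \<longleftrightarrow> {x, y} \<in> E \<and> c {x, y} = a"

definition sees :: "'a \<Rightarrow> nat \<Rightarrow> bool" where
  "sees x a \<longleftrightarrow> (\<exists>y. nbr a x y)"

definition missing :: "'a \<Rightarrow> nat" where
  "missing x = (THE a. a \<in> {1..4} \<and> \<not> sees x a)"

lemma nbr_sym: "nbr a x y \<Longrightarrow> nbr a y x"
  unfolding nbr_def by (simp add: insert_commute)

lemma nbr_in_V: "nbr a x y \<Longrightarrow> x \<in> V" "nbr a x y \<Longrightarrow> y \<in> V"
  using simple unfolding nbr_def simple_graph_def by auto

lemma nbr_neq: "nbr a x y \<Longrightarrow> x \<noteq> y"
  using simple unfolding nbr_def simple_graph_def by fastforce

lemma nbr_color: "nbr a x y \<Longrightarrow> a \<in> {1..4}"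
  using star unfolding nbr_def star_edge_coloring_def proper_edge_coloring_def by blast

lemma nbr_unique:
  assumes "nbr a x y" "nbr a x z"
  shows "y = z"
proof -
  have "{x, y} = {x, z}"
    using assms star unfolding nbr_def star_edge_coloring_def proper_edge_coloring_def
    by (metis disjoint_iff insertI1)
  then show ?thesis by (auto simp: doubleton_eq_iff)
qed

lemma nbr_same_edge: "nbr a x y \<Longrightarrow> nbr b x y \<Longrightarrow> a = b"
  unfolding nbr_def by simp

lemma sees_iff_not_missing:
  assumes x: "x \<in> V"
  shows missing_color: "missing x \<in> {1..4}"
    and "a \<in> {1..4} \<Longrightarrow> sees x a \<longleftrightarrow> a \<noteq> missing x"
proof -
  have "{a. sees x a} = c ` {e \<in> E. x \<in> e}"
  proof (intro equalityI subsetI)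
    fix a assume "a \<in> c ` {e \<in> E. x \<in> e}"
    then obtain e where e: "e \<in> E" "x \<in> e" "a = c e" by auto
    then obtain y where "e = {x, y}" using simple_graph_edgeE[OF simple] by metis
    then show "a \<in> {a. sees x a}" using e unfolding sees_def nbr_def by auto
  qed (auto simp: sees_def nbr_def)
  moreover have "inj_on c {e \<in> E. x \<in> e}"
    using star unfolding star_edge_coloring_def proper_edge_coloring_def inj_on_def by blast
  ultimately have "card {a. sees x a} = 3"
    using cubic[OF x] unfolding vdegree_def by (simp add: card_image)
  moreover have sub: "{a. sees x a} \<subseteq> {1..4}" using nbr_color unfolding sees_def by blast
  moreover have "finite {a. sees x a}" using sub finite_subset by blast
  ultimately have "card ({1..4} - {a. sees x a}) = 1" by (simp add: card_Diff_subset)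
  then obtain d where d: "{1..4} - {a. sees x a} = {d}" by (rule card_1_singletonE)
  have iff: "a \<in> {1..4} \<and> \<not> sees x a \<longleftrightarrow> a = d" for a
  proof -
    have "a \<in> {1..4} - {a. sees x a} \<longleftrightarrow> a \<in> {d}" by (simp only: d)
    then show ?thesis by simp
  qed
  have "missing x = d" unfolding missing_def iff by simp
  then show "missing x \<in> {1..4}" "a \<in> {1..4} \<Longrightarrow> sees x a \<longleftrightarrow> a \<noteq> missing x"
    using iff by blast+
qed

lemma missing_neq_color: "nbr a x y \<Longrightarrow> missing x \<noteq> a"
  using sees_iff_not_missing(2) nbr_in_V(1) nbr_color unfolding sees_def by blast

text \<open>A properly colored walk with colors \<open>a b a b\<close> is a path of length four or a cycle of length
  four: properness rules out every coincidence of vertices except that of the two ends.\<close>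

lemma no_bicolored_walk:
  assumes n: "nbr a u v" "nbr b v w" "nbr a w x" "nbr b x y" and ab: "a \<noteq> b"
  shows False
proof -
  have inV: "{u, v, w, x, y} \<subseteq> V" using n nbr_in_V by blast
  have inE: "{{u, v}, {v, w}, {w, x}, {x, y}} \<subseteq> E" using n unfolding nbr_def by auto
  have cols: "c ` {{u, v}, {v, w}, {w, x}, {x, y}} = {a, b}" using n unfolding nbr_def by auto
  have neq: "u \<noteq> v" "v \<noteq> w" "w \<noteq> x" "x \<noteq> y" using n nbr_neq by auto
  have neq2: "u \<noteq> w" "v \<noteq> x" "w \<noteq> y"
    using n ab nbr_same_edge nbr_sym by metis+
  have neq3: "u \<noteq> x" "v \<noteq> y"
    using n neq nbr_unique nbr_sym by metis+
  show False
  proof (cases "u = y")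
    case True
    let ?p = "[u, v, w, x]"
    have "cycle_edges ?p = {{u, v}, {v, w}, {w, x}, {x, y}}"
      using True unfolding cycle_edges_def
      by (simp add: path_edges_Cons) (auto simp: path_edges_def)
    moreover from this have "is_cycle V E ?p"
      using inV inE neq neq2 neq3 unfolding is_cycle_def by auto
    ultimately show False
      using star cols ab unfolding star_edge_coloring_def bicolored_def by fastforce
  next
    case False
    let ?p = "[u, v, w, x, y]"
    have "path_edges ?p = {{u, v}, {v, w}, {w, x}, {x, y}}"
      by (simp add: path_edges_Cons) (auto simp: path_edges_def)
    moreover from this have "is_path V E ?p"
      using inV inE neq neq2 neq3 False unfolding is_path_def by auto
    ultimately show False
      using star cols ab unfolding star_edge_coloring_def bicolored_def by fastforce
  qed
qed

text \<open>The obstruction at work: if \<open>y\<close> saw \<open>a\<close>, then the edges of color \<open>b\<close> at \<open>x\<close> and of color \<open>a\<close> at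
  \<open>y\<close> would extend the walk \<open>x v y\<close> to a bicolored one.\<close>

lemma missing_eqI:
  assumes "nbr a v x" "nbr b v y" "a \<noteq> b" "sees x b"
  shows "missing y = a"
proof -
  obtain u where "nbr b u x" using assms(4) nbr_sym unfolding sees_def by blast
  then have "\<not> sees y a"
    using no_bicolored_walk[of b u x a v y] assms(1-3) nbr_sym unfolding sees_def by blast
  then show ?thesis
    using sees_iff_not_missing(2)[of y a] assms nbr_in_V(2) nbr_color by blast
qed

text \<open>The vertex \<open>x\<close> sees \<open>b\<close> or \<open>e\<close>, since it misses only one color. Either choice determines what
  the next neighbour misses, hence that this one sees what is needed to go on to the third, and
  back to \<open>x\<close>.\<close>

lemma missing_neighbours:
  assumes n: "nbr a v x" "nbr b v y" "nbr e v z" and d: "distinct [a, b, e]"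
  shows "missing x = e \<and> missing y = a \<and> missing z = b \<or>
         missing x = b \<and> missing y = e \<and> missing z = a"
proof -
  have V: "x \<in> V" "y \<in> V" "z \<in> V" and col: "a \<in> {1..4}" "b \<in> {1..4}" "e \<in> {1..4}"
    using n nbr_in_V nbr_color by auto
  note sees = sees_iff_not_missing(2)
  show ?thesis
  proof (cases "sees x b")
    case True
    have "missing y = a" using missing_eqI[OF n(1,2) _ True] d by simp
    moreover from this have "missing z = b"
      using missing_eqI[OF n(2,3)] sees[OF V(2) col(3)] d by auto
    moreover from this have "missing x = e"
      using missing_eqI[OF n(3,1)] sees[OF V(3) col(1)] d by auto
    ultimately show ?thesis by simp
  next
    case False
    then have b: "missing x = b" using sees[OF V(1) col(2)] by simp
    then have "missing z = a" using missing_eqI[OF n(1,3)] sees[OF V(1) col(3)] d by auto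
    moreover from this have "missing y = e"
      using missing_eqI[OF n(3,2)] sees[OF V(3) col(2)] d by auto
    ultimately show ?thesis using b by simp
  qed
qed

lemma complete_colors:
  assumes v: "v \<in> V" and a: "a \<in> {1..4}" "a \<noteq> missing v" and b: "b \<in> {1..4}" "b \<noteq> missing v"
    and ab: "a \<noteq> b"
  obtains e where "{missing v, a, b, e} = {1..4}" "distinct [missing v, a, b, e]"
    "e + missing v + a + b = 10"
proof -
  have "\<exists>e. {m, a, b, e} = {1..4} \<and> distinct [m, a, b, e] \<and> e + m + a + b = 10"
    if "m \<in> {1..4}" "a \<noteq> m" "b \<noteq> m" for m
  proof -
    have iv: "{1..4} = {1, 2, 3, 4::nat}" by auto
    show ?thesis
      using that a(1) b(1) ab unfolding iv
      by (intro exI[of _ "10 - m - a - b"]) (elim insertE emptyE; simp; blast)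
  qed
  then show ?thesis using that missing_color[OF v] a(2) b(2) by metis
qed

lemma other_neighbours:
  assumes "nbr a v x"
  obtains b e y z where "nbr b v y" "nbr e v z" "{missing v, a, b, e} = {1..4}"
    "distinct [missing v, a, b, e]"
proof -
  have v: "v \<in> V" and a: "a \<in> {1..4}" "a \<noteq> missing v"
    using assms nbr_in_V nbr_color missing_neq_color by blast+
  have "card ({1..4} - {a, missing v}) = 2"
    using a missing_color[OF v] by (simp add: card_Diff_subset)
  then have "{1..4} - {a, missing v} \<noteq> {}" by (metis card.empty zero_neq_numeral)
  then obtain b where b: "b \<in> {1..4}" "b \<noteq> missing v" "a \<noteq> b" by blast
  obtain e where e: "{missing v, a, b, e} = {1..4}" "distinct [missing v, a, b, e]"
    using complete_colors[OF v a b] .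
  have "e \<in> {1..4}" using e(1) by blast
  then have "sees v b" "sees v e"
    using sees_iff_not_missing(2)[OF v] b e(2) by auto
  then show ?thesis using that e unfolding sees_def by blast
qed

lemma missing_neq:
  assumes "nbr a v x"
  shows "missing x \<noteq> missing v"
proof -
  obtain b e y z where "nbr b v y" "nbr e v z" "distinct [missing v, a, b, e]"
    using other_neighbours[OF assms] by metis
  then show ?thesis using missing_neighbours[OF assms] by fastforce
qed

lemma unique_neighbour_missing:
  assumes v: "v \<in> V" and f: "f \<in> {1..4}" "f \<noteq> missing v"
  shows "\<exists>!x. {v, x} \<in> E \<and> missing x = f"
proof -
  obtain x where x: "nbr f v x" using sees_iff_not_missing(2)[OF v] f unfolding sees_def by blast
  obtain b e y z where yz: "nbr b v y" "nbr e v z"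
    and e: "{missing v, f, b, e} = {1..4}" "distinct [missing v, f, b, e]"
    using other_neighbours[OF x] .
  note n = x yz
  have only: "w = x \<or> w = y \<or> w = z" if "{v, w} \<in> E" for w
  proof -
    have w: "nbr (c {v, w}) v w" using that unfolding nbr_def by simp
    then have "c {v, w} \<in> {missing v, f, b, e}" using nbr_color e(1) by blast
    then have "c {v, w} \<in> {f, b, e}" using missing_neq_color[OF w] by auto
    then show ?thesis using w n nbr_unique by blast
  qed
  have edges: "{v, y} \<in> E" "{v, z} \<in> E" using n unfolding nbr_def by auto
  have d: "f \<noteq> b" "f \<noteq> e" "b \<noteq> e" using e(2) by auto
  from missing_neighbours[OF n] d
  have "missing x = e \<and> missing y = f \<and> missing z = b \<or>
        missing x = b \<and> missing y = e \<and> missing z = f" by simp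
  then show ?thesis using only edges d by metis
qed

text \<open>The edges between two classes of missing colors form a perfect matching of these classes.\<close>

lemma four_dvd_card: "4 dvd card V"
proof -
  define cls where "cls d = {v \<in> V. missing v = d}" for d
  have finV: "finite V" using simple unfolding simple_graph_def by simp
  have le: "card (cls d) \<le> card (cls f)" if d: "d \<in> {1..4}" and f: "f \<in> {1..4}" for d f
  proof (cases "d = f")
    case False
    show ?thesis
    proof (rule card_le_if_inj_on_rel[where r = "\<lambda>v x. {v, x} \<in> E"])
      show "finite (cls f)" using finV unfolding cls_def by simp
    next
      fix v assume "v \<in> cls d"
      then have "\<exists>!x. {v, x} \<in> E \<and> missing x = f"
        using unique_neighbour_missing f False unfolding cls_def by auto
      then show "\<exists>x. x \<in> cls f \<and> {v, x} \<in> E"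
        using simple unfolding cls_def simple_graph_def by blast
    next
      fix v v' x assume "v \<in> cls d" "v' \<in> cls d" "x \<in> cls f" "{v, x} \<in> E" "{v', x} \<in> E"
      then show "v = v'"
        using unique_neighbour_missing[of x d] d False unfolding cls_def
        by (auto simp: insert_commute)
    qed
  qed simp
  have "V = (\<Union>d\<in>{1..4}. cls d)" using missing_color unfolding cls_def by auto
  then have "card V = card (\<Union>d\<in>{1..4}. cls d)" by simp
  also have "\<dots> = (\<Sum>d\<in>{1..4}. card (cls d))"
    by (rule card_UN_disjoint) (use finV in \<open>auto simp: cls_def\<close>)
  also have "\<dots> = (\<Sum>d\<in>{1..4::nat}. card (cls 1))"
    by (rule sum.cong) (auto intro!: antisym le)
  finally show ?thesis by simp
qed

text \<open>The colors sum to 10, so the last argument is the remaining color.\<close>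

definition edge_sign :: "'a \<Rightarrow> nat \<Rightarrow> 'a \<Rightarrow> int" where
  "edge_sign v a x =
     vandermonde4 (missing v) a (missing x) (10 - int (missing v) - int a - int (missing x))"

lemma edge_sign_swap: "edge_sign x a v = - edge_sign v a x"
proof -
  have "10 - int (missing x) - int a - int (missing v) =
        10 - int (missing v) - int a - int (missing x)" by simp
  then show ?thesis unfolding edge_sign_def by (metis vandermonde4_swap)
qed

text \<open>By \<open>missing_neighbours\<close>, changing the edge at \<open>v\<close> rotates the last three colors of the
  arrangement, which is an even permutation.\<close>

lemma edge_sign_eq:
  assumes n: "nbr a v x" "nbr b v y"
  shows "edge_sign v a x = edge_sign v b y"
proof (cases "a = b")
  case True
  then show ?thesis using n nbr_unique by blast
next
  case False
  have V: "v \<in> V" and a: "a \<in> {1..4}" "a \<noteq> missing v" and b: "b \<in> {1..4}" "b \<noteq> missing v"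
    using n nbr_in_V nbr_color missing_neq_color by blast+
  obtain e where e: "{missing v, a, b, e} = {1..4}" "distinct [missing v, a, b, e]"
      "e + missing v + a + b = 10"
    using complete_colors[OF V a b False] .
  have "e \<in> {1..4}" using e(1) by blast
  then have "sees v e" using sees_iff_not_missing(2)[OF V] e(2) by auto
  then obtain z where z: "nbr e v z" unfolding sees_def by blast
  have s: "int e + int (missing v) + int a + int b = 10" using e(3) by linarith
  have "missing x = e \<and> missing y = a \<or> missing x = b \<and> missing y = e"
    using missing_neighbours[OF n z] e(2) by auto
  then show ?thesis
  proof (elim disjE conjE)
    assume m: "missing x = e" "missing y = a"
    have "10 - int (missing v) - int a - int e = b" "10 - int (missing v) - int b - int a = e"
      using s by linarith+
    then show ?thesis using m unfolding edge_sign_def by (metis vandermonde4_rotate)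
  next
    assume m: "missing x = b" "missing y = e"
    have "10 - int (missing v) - int a - int b = e" "10 - int (missing v) - int b - int e = a"
      using s by linarith+
    then show ?thesis using m unfolding edge_sign_def by (metis vandermonde4_rotate)
  qed
qed

lemma edge_sign_nonzero:
  assumes n: "nbr a v x"
  shows "edge_sign v a x \<noteq> 0"
proof -
  have V: "v \<in> V" "x \<in> V" and a: "a \<in> {1..4}"
    using n nbr_in_V nbr_color by blast+
  have ne: "a \<noteq> missing v" "missing x \<noteq> missing v" "missing x \<noteq> a"
    using n nbr_sym missing_neq_color missing_neq by metis+
  obtain e where e: "distinct [missing v, a, missing x, e]" "e + missing v + a + missing x = 10"
    using complete_colors[OF V(1) a ne(1) missing_color[OF V(2)] ne(2)] ne(3) by metis
  have "10 - int (missing v) - int a - int (missing x) = int e" using e(2) by linarith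
  then show ?thesis using e(1) unfolding edge_sign_def vandermonde4_def by auto
qed

text \<open>The sign at the vertices, read off the edge to the next one, alternates around the cycle and is
  never zero.\<close>

lemma even_cycle:
  assumes cyc: "is_cycle V E p"
  shows "even (length p)"
proof -
  let ?n = "length p"
  have len: "?n \<ge> 3" and ce: "cycle_edges p \<subseteq> E" using cyc unfolding is_cycle_def by auto
  define nxt where "nxt i = Suc i mod ?n" for i
  define s where "s i = edge_sign (p ! i) (c {p ! i, p ! nxt i}) (p ! nxt i)" for i
  have nbr: "nbr (c {p ! i, p ! nxt i}) (p ! i) (p ! nxt i)" if "i < ?n" for i
  proof -
    have "{p ! i, p ! nxt i} \<in> cycle_edges p"
      using that unfolding in_cycle_edges_iff[OF len] nxt_def by blast
    then show ?thesis using ce unfolding nbr_def by auto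
  qed
  have "0 < ?n" using len by linarith
  then have lt: "nxt i < ?n" for i unfolding nxt_def by (rule mod_less_divisor)
  have alt: "s (nxt i) = - s i" if "i < ?n" for i
  proof -
    have "s (nxt i) = edge_sign (p ! nxt i) (c {p ! i, p ! nxt i}) (p ! i)"
      unfolding s_def by (rule edge_sign_eq[OF nbr[OF lt] nbr_sym[OF nbr[OF that]]])
    also have "\<dots> = - s i" unfolding s_def by (rule edge_sign_swap)
    finally show ?thesis .
  qed
  have pow: "i < ?n \<Longrightarrow> s i = (-1) ^ i * s 0" for i
  proof (induction i)
    case (Suc i)
    then have "s (Suc i) = - s i" using alt[of i] unfolding nxt_def by simp
    then show ?case using Suc by simp
  qed simp
  have "s 0 = - s (?n - 1)" using alt[of "?n - 1"] \<open>0 < ?n\<close> unfolding nxt_def by simp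
  also have "\<dots> = - ((-1) ^ (?n - 1) * s 0)" using pow[of "?n - 1"] \<open>0 < ?n\<close> by simp
  also have "\<dots> = (-1) ^ ?n * s 0" using \<open>0 < ?n\<close> by (cases ?n) auto
  finally have "s 0 = (-1) ^ ?n * s 0" .
  moreover have "s 0 \<noteq> 0" unfolding s_def by (rule edge_sign_nonzero[OF nbr[OF \<open>0 < ?n\<close>]])
  ultimately show ?thesis by (cases "even ?n") auto
qed

end

section \<open>The lower bound\<close>

lemma star_edge_coloring_mono:
  assumes "star_edge_coloring V E k c" "k \<le> l"
  shows "star_edge_coloring V E l c"
proof -
  have "{1..k} \<subseteq> {1..l}" using assms(2) by auto
  then show ?thesis
    using assms(1) unfolding star_edge_coloring_def proper_edge_coloring_def
    by (meson subset_trans)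
qed

lemma not_bicolored_if_three_edges:
  assumes "inj_on c E" "F \<subseteq> E" "{e, f, g} \<subseteq> F" "distinct [e, f, g]" "finite E"
  shows "\<not> bicolored c F"
proof -
  have "card {e, f, g} \<le> card F" using assms finite_subset by (intro card_mono) auto
  moreover have "card {e, f, g} = 3" using assms(4) by simp
  moreover have "card (c ` F) = card F" using assms inj_on_subset by (intro card_image) blast
  ultimately show ?thesis unfolding bicolored_def by simp
qed

text \<open>Different colors for all edges: the first three edges of a path or cycle then have three
  colors.\<close>

lemma star_edge_coloring_exists:
  assumes sg: "simple_graph V E"
  shows "\<exists>k\<ge>1. \<exists>c. star_edge_coloring V E k c"
proof -
  have fin: "finite E" using simple_graph_finite_edges[OF sg] .
  then obtain h where h: "bij_betw h E {0..<card E}" using ex_bij_betw_finite_nat by blast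
  define c where "c e = Suc (h e)" for e
  have inj: "inj_on c E" using h unfolding c_def bij_betw_def inj_on_def by simp
  have img: "c ` E \<subseteq> {1..Suc (card E)}"
  proof -
    have "h e \<le> card E" if "e \<in> E" for e using bij_betwE[OF h] that by force
    then show ?thesis unfolding c_def by auto
  qed
  have three: "\<not> bicolored c F"
    if "distinct p" "length p \<ge> 4" "path_edges p \<subseteq> F" "F \<subseteq> E" for p F
  proof (rule not_bicolored_if_three_edges[OF inj \<open>F \<subseteq> E\<close> _ _ fin])
    have "{p ! 0, p ! Suc 0} \<in> path_edges p" "{p ! 1, p ! Suc 1} \<in> path_edges p"
      "{p ! 2, p ! Suc 2} \<in> path_edges p"
      by (rule path_edgesI; use that in simp)+
    then show "{{p ! 0, p ! Suc 0}, {p ! 1, p ! Suc 1}, {p ! 2, p ! Suc 2}} \<subseteq> F"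
      using that by blast
    have "p ! i \<noteq> p ! j" if "i < 4" "j < 4" "i \<noteq> j" for i j
      using that \<open>distinct p\<close> \<open>length p \<ge> 4\<close> by (simp add: nth_eq_iff_index_eq)
    then show "distinct [{p ! 0, p ! Suc 0}, {p ! 1, p ! Suc 1}, {p ! 2, p ! Suc 2}]"
      by (simp add: doubleton_eq_iff)
  qed
  have "star_edge_coloring V E (Suc (card E)) c"
    unfolding star_edge_coloring_def proper_edge_coloring_def
  proof (intro conjI allI impI ballI)
    show "c ` E \<subseteq> {1..Suc (card E)}" by (fact img)
  next
    fix e f assume "e \<in> E" "f \<in> E" "e \<noteq> f \<and> e \<inter> f \<noteq> {}"
    then show "c e \<noteq> c f" using inj unfolding inj_on_def by blast
  next
    fix p assume "is_path V E p \<and> length p = 5"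
    then show "\<not> bicolored c (path_edges p)" using three[of p] unfolding is_path_def by auto
  next
    fix p assume "is_cycle V E p \<and> length p = 4"
    then show "\<not> bicolored c (cycle_edges p)"
      using three[of p "cycle_edges p"] unfolding is_cycle_def cycle_edges_def by auto
  qed
  then show ?thesis by (intro exI[of _ "Suc (card E)"]) auto
qed

theorem theorem2p1:
  fixes V :: "'a set" and E :: "'a set set"
  assumes "cubic_halin_graph V E"
  shows "star_chromatic_index V E \<ge> 5"
proof (rule ccontr)
  obtain T C where halin: "halin_decomposition V E T C"
    and deg: "\<forall>v \<in> V - leaves V T. vdegree T v = 3"
    using assms unfolding cubic_halin_graph_def by blast
  have sg: "simple_graph V E" and cyc: "is_cycle V E C"
    using halin unfolding halin_decomposition_def by auto
  assume "\<not> star_chromatic_index V E \<ge> 5"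
  moreover have "\<exists>c. star_edge_coloring V E (star_chromatic_index V E) c"
    using LeastI_ex[OF star_edge_coloring_exists[OF sg]] unfolding star_chromatic_index_def by blast
  ultimately obtain c where "star_edge_coloring V E 4 c"
    using star_edge_coloring_mono[of V E "star_chromatic_index V E" _ 4] by auto
  then interpret star4_colored_cubic V E c
    using sg cubic_halin_regular[OF halin deg] by unfold_locales auto
  obtain m where "card V = 4 * m" using four_dvd_card by blast
  then have "length C = 2 * m + 1" using cubic_halin_card[OF halin deg] by simp
  then show False using even_cycle[OF cyc] by simp
qed

end
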